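(* Let $n,m$ be integers with $n\ge 2$ and $n\le m\le \lfloor n/2\rfloor\lceil n/2\rceil$. Let $$k_0=\max\{k : \lceil n/2\rceil\le k\le n-q-\mathrm{sgn}(r),\ \text{where } m=qk+r,\ 0\le r<k\}.$$ Suppose $B^\ast$ is a bipartite graph with $n$ vertices and $m$ edges such that $\sigma_2(B^\ast)$ attains the maximum value of $\sigma_2$ among all bipartite graphs with $n$ vertices and $m$ edges. Then: (a) if $m>(n-k_0)(k_0-1)$, then $B^\ast\cong B^l(n,m,k_0)$ or $B^\ast\cong B^l(n,m,n-k_0)$; (b) if $m=(n-k_0)(k_0-1)$, then $B^\ast\cong B^l(n,m,k_0)$, $B^\ast\cong B^l(n,m,n-k_0)$, or $B^\ast\cong B^l(n,m,k_0-1)$; (c) if $m<(n-k_0)(k_0-1)$, then $B^\ast\cong B^l(n,m,k_0)$.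
   Context: All graphs are finite, simple and undirected. For a graph $G$, $\sigma_2(G)=\sum_{v\in V(G)} d(v)^2$, where $d(v)$ is the degree of $v$. $\mathrm{sgn}(x)$ is $1,-1,0$ according as $x$ is positive, negative, zero. For integers $n\ge2$, $0\le m\le\lfloor n/2\rfloor\lceil n/2\rceil$, $1\le k\le n-1$, write $m=qk+r$ with $0\le r<k$; then $B^l(n,m,k)$ denotes the bipartite graph with $n$ vertices and $m$ edges and bipartition $(X,Y)$, $|X|=k$, $|Y|=n-k$, in which $q$ vertices of $Y$ are adjacent to all vertices of $X$, one further vertex of $Y$ is adjacent to exactly $r$ vertices of $X$ if $r>0$, and there are no other edges. *)

theory Defs
  imports Main
begin

record 'a ugraph =
  verts :: "'a set"
  edges :: "'a set set"

definition simple_graph :: "'a ugraph \<Rightarrow> bool" where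
  "simple_graph G \<longleftrightarrow> finite (verts G) \<and> (\<forall>e\<in>edges G. e \<subseteq> verts G \<and> card e = 2)"

definition degree :: "'a ugraph \<Rightarrow> 'a \<Rightarrow> nat" where
  "degree G v = card {e \<in> edges G. v \<in> e}"

definition sigma2 :: "'a ugraph \<Rightarrow> nat" where
  "sigma2 G = (\<Sum>v\<in>verts G. (degree G v)\<^sup>2)"

definition bipartition :: "'a ugraph \<Rightarrow> 'a set \<Rightarrow> 'a set \<Rightarrow> bool" where
  "bipartition G X Y \<longleftrightarrow> X \<union> Y = verts G \<and> X \<inter> Y = {} \<and>
     (\<forall>e\<in>edges G. \<exists>x\<in>X. \<exists>y\<in>Y. e = {x, y})"

definition bipartite :: "'a ugraph \<Rightarrow> bool" where
  "bipartite G \<longleftrightarrow> (\<exists>X Y. bipartition G X Y)"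

definition bipartite_graphs :: "nat \<Rightarrow> nat \<Rightarrow> 'a ugraph set" where
  "bipartite_graphs n m =
     {G. simple_graph G \<and> bipartite G \<and> card (verts G) = n \<and> card (edges G) = m}"

definition graph_iso :: "'a ugraph \<Rightarrow> 'b ugraph \<Rightarrow> bool" (infix "\<simeq>" 50) where
  "G \<simeq> H \<longleftrightarrow> (\<exists>f. bij_betw f (verts G) (verts H) \<and>
     (\<forall>u\<in>verts G. \<forall>v\<in>verts G. {u, v} \<in> edges G \<longleftrightarrow> {f u, f v} \<in> edges H))"

text \<open>
  A concrete model of \<open>B\<^sup>l(n,m,k)\<close>: the part \<open>X\<close> consists of the vertices \<open>Inl i\<close> with \<open>i < k\<close>,
  the part \<open>Y\<close> of the vertices \<open>Inr j\<close> with \<open>j < n - k\<close>.  It has \<open>m\<close> edges only if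
  \<open>m \<le> k * (n - k)\<close>, i.e. if \<open>Y\<close> is large enough for the description to make sense.
\<close>

definition Bl :: "nat \<Rightarrow> nat \<Rightarrow> nat \<Rightarrow> (nat + nat) ugraph" where
  "Bl n m k = (let q = m div k; r = m mod k in
     \<lparr> verts = Inl ` {..<k} \<union> Inr ` {..<n - k},
       edges = {{Inl i, Inr j} | i j. i < k \<and> j < n - k \<and> (j < q \<or> (j = q \<and> i < r))} \<rparr>)"

definition k0 :: "nat \<Rightarrow> nat \<Rightarrow> nat" where
  "k0 n m = Max {k. (n + 1) div 2 \<le> k \<and>
                    int k \<le> int n - int (m div k) - sgn (int (m mod k))}"

lemma Bl_simple_graph: "simple_graph (Bl n m k)"
  by (auto simp: simple_graph_def Bl_def Let_def)

lemma Bl_bipartition: "bipartition (Bl n m k) (Inl ` {..<k}) (Inr ` {..<n - k})"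
  unfolding bipartition_def Bl_def Let_def by fastforce

lemma Bl_in_bipartite_graphs:
  assumes "0 < k" "k \<le> n" "m \<le> k * (n - k)"
  shows "Bl n m k \<in> bipartite_graphs n m"
proof -
  have v: "card (verts (Bl n m k)) = n"
  proof -
    have "card (Inl ` {..<k} \<union> Inr ` {..<n - k} :: (nat + nat) set) = k + (n - k)"
      by (subst card_Un_disjoint) (auto simp: card_image)
    then show ?thesis using assms(2) by (simp add: Bl_def Let_def)
  qed
  have lt: "j < m div k \<or> (j = m div k \<and> i < m mod k) \<longleftrightarrow> j * k + i < m" if "i < k" for i j
  proof -
    have "j * k + i < m \<longleftrightarrow> j * k + i < (m div k) * k + m mod k" by simp
    also have "\<dots> \<longleftrightarrow> j < m div k \<or> (j = m div k \<and> i < m mod k)"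
    proof (cases j "m div k" rule: linorder_cases)
      case less
      then have "Suc j * k \<le> (m div k) * k" by (intro mult_le_mono1) simp
      then have "j * k + i < (m div k) * k + m mod k"
        using that by (simp only: mult_Suc)
      then show ?thesis using less by blast
    next
      case greater
      then have "Suc (m div k) * k \<le> j * k" by (intro mult_le_mono1) simp
      moreover have "m mod k < k" using assms(1) by simp
      ultimately have "\<not> j * k + i < (m div k) * k + m mod k"
        by (simp only: mult_Suc)
      then show ?thesis using greater by auto
    next
      case equal
      then show ?thesis by (simp only: add_less_cancel_left) blast
    qed
    finally show ?thesis ..
  qed
  let ?f = "\<lambda>t. {Inl (t mod k), Inr (t div k)} :: (nat + nat) set"
  have "edges (Bl n m k) = ?f ` {..<m}"
  proof (intro equalityI subsetI)
    fix e assume "e \<in> edges (Bl n m k)"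
    then obtain i j where "e = {Inl i, Inr j}" "i < k" "j * k + i < m"
      unfolding Bl_def Let_def using lt by auto
    then show "e \<in> ?f ` {..<m}" by (intro image_eqI[of _ _ "j * k + i"]) auto
  next
    fix e assume "e \<in> ?f ` {..<m}"
    then obtain t where t: "t < m" "e = ?f t" by auto
    have "t mod k < k" using assms(1) by simp
    moreover have "t div k < n - k"
      using t(1) assms by (simp add: less_mult_imp_div_less mult.commute)
    moreover have "t div k * k + t mod k < m" using t(1) by simp
    ultimately show "e \<in> edges (Bl n m k)"
      unfolding Bl_def Let_def using lt[of "t mod k" "t div k"] t(2) by auto
  qed
  moreover have "inj_on ?f {..<m}"
  proof (rule inj_onI)
    fix s t assume "?f s = ?f t"
    then have "s mod k = t mod k" "s div k = t div k" by (auto simp: doubleton_eq_iff)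
    then show "s = t" by (metis div_mult_mod_eq)
  qed
  ultimately have "card (edges (Bl n m k)) = m" by (simp add: card_image)
  then show ?thesis
    using v Bl_simple_graph Bl_bipartition unfolding bipartite_graphs_def bipartite_def by blast
qed

lemma k0_set:
  assumes "n \<ge> 2" "m \<le> n div 2 * ((n + 1) div 2)"
  defines "K \<equiv> {k. (n + 1) div 2 \<le> k \<and> int k \<le> int n - int (m div k) - sgn (int (m mod k))}"
  shows "finite K" and "(n + 1) div 2 \<in> K"
proof -
  have "k \<le> n" if "k \<in> K" for k
  proof -
    have "0 \<le> sgn (int (m mod k))" by (simp add: sgn_if)
    then show ?thesis using that unfolding K_def mem_Collect_eq by linarith
  qed
  then show "finite K" by (meson atMost_iff finite_atMost finite_subset subsetI)
next
  let ?k = "(n + 1) div 2"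
  have n: "n = n div 2 + ?k" and k: "?k > 0" using assms(1) by presburger+
  have "m div ?k + (if m mod ?k = 0 then 0 else 1) \<le> n div 2"
  proof (cases "m mod ?k = 0")
    case True
    have "m div ?k \<le> (n div 2 * ?k) div ?k" by (rule div_le_mono[OF assms(2)])
    then show ?thesis using True k by simp
  next
    case False
    then have "m \<noteq> n div 2 * ?k" by (metis mod_mult_self2_is_0)
    then have "m < n div 2 * ?k" using assms(2) by simp
    then show ?thesis using False by (simp add: less_mult_imp_div_less Suc_leI)
  qed
  then show "?k \<in> K" using n unfolding K_def by (auto simp: sgn_if split: if_splits)
qed

end

theory Submission
  imports Defs
begin

text \<open>
  View a bipartite graph as a relation \<open>R \<subseteq> X \<times> Y\<close> and let \<open>fillval a m\<close> be the value of \<open>\<sigma>\<^sub>2\<close> on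
  \<open>B\<^sup>l(n,m,a)\<close>. Moving an edge from a vertex to one of at least the same degree increases \<open>\<sigma>\<^sub>2\<close>, so
  for upper bounds the neighbourhoods may be assumed nested. In whichever part has at least as many
  non-isolated vertices as the other, let there be \<open>c\<close> of them: some vertex of the other part is
  joined to all of these, and deleting it lowers \<open>\<sigma>\<^sub>2\<close> by an amount depending only on \<open>c\<close> and \<open>m\<close>.
  By induction \<open>\<sigma>\<^sub>2 \<le> fillval a m\<close> whenever both parts have at most \<open>a\<close> vertices.

  For \<open>m = q a + r \<le> a\<^sup>2\<close> with \<open>0 \<le> r < a\<close>, the difference
  \<open>fillval (a + 1) m - fillval a m = 2 min(q,r) (a - max(q,r))\<close> is nonnegative, and if also
  \<open>a \<le> m\<close> it vanishes only when \<open>a\<close> divides \<open>m\<close>. Since \<open>k\<^sub>0\<close> is the largest \<open>k\<close> with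
  \<open>m \<le> k (n - k)\<close>, the larger part \<open>X\<close> of an extremal graph has \<open>k\<^sub>0\<close> vertices, or \<open>k\<^sub>0 - 1\<close> with
  \<open>m = (n - k\<^sub>0) (k\<^sub>0 - 1)\<close>.

  Either way the bipartite complement has at most \<open>|X|\<close> edges. For fixed parts and \<open>m\<close>, passing to
  the complement changes \<open>\<sigma>\<^sub>2\<close> by a constant. As \<open>\<sigma>\<^sub>2\<close> is the sum of \<open>d(x) + d(y)\<close> over the edges
  \<open>xy\<close>, it is at most \<open>t (t + 1)\<close> for \<open>t\<close> edges, with equality only if any two edges meet. Hence
  the complement of an extremal graph is a star, and such a graph is a \<open>B\<^sup>l\<close>.
\<close>

section \<open>The extremal value\<close>

text \<open>
  With \<open>m = q a + r\<close> this is \<open>\<sigma>\<^sub>2(B\<^sup>l(n,m,a)) = q a\<^sup>2 + r\<^sup>2 + r (q + 1)\<^sup>2 + (a - r) q\<^sup>2\<close>,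
  expanded so that no subtraction occurs.
\<close>

definition fillval :: "nat \<Rightarrow> nat \<Rightarrow> nat" where
  "fillval a m = (let q = m div a; r = m mod a in q * a\<^sup>2 + a * q\<^sup>2 + 2 * q * r + r\<^sup>2 + r)"

lemma fillval_mult_add:
  assumes "r \<le> a"
  shows "fillval a (q * a + r) = q * a\<^sup>2 + a * q\<^sup>2 + 2 * q * r + r\<^sup>2 + r"
proof (cases "r = a")
  case True
  have "fillval a (Suc q * a) = Suc q * a\<^sup>2 + a * (Suc q)\<^sup>2"
    by (cases "a = 0") (simp_all add: fillval_def)
  then show ?thesis
    using True by (simp add: power2_eq_square algebra_simps)
next
  case False
  then show ?thesis
    using assms by (simp add: fillval_def Let_def)
qed

lemma fillval_add_self:
  assumes "a > 0"
  shows "fillval a (a + m) = a\<^sup>2 + a + 2 * m + fillval a m"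
proof -
  define q r where "q = m div a" and "r = m mod a"
  have m_eq: "m = q * a + r" and r_le: "r \<le> a"
    using assms by (simp_all add: q_def r_def less_imp_le)
  have "fillval a (a + m) = fillval a (Suc q * a + r)"
    by (simp add: m_eq add.assoc)
  then show ?thesis
    unfolding m_eq fillval_mult_add[OF r_le] by (simp add: power2_eq_square algebra_simps)
qed

lemma fillval_deficit:
  assumes "m + t = a * b" "t \<le> a" "b > 0"
  shows "fillval a m + 2 * (a + b) * t = a * b * (a + b) + t\<^sup>2 + t"
proof -
  obtain q where b_eq: "b = Suc q"
    using assms(3) gr0_implies_Suc by blast
  obtain r where a_eq: "a = t + r"
    using assms(2) le_Suc_ex by blast
  have "m = q * a + r"
    using assms(1) by (simp add: a_eq b_eq algebra_simps)
  then have "fillval a m = q * a\<^sup>2 + a * q\<^sup>2 + 2 * q * r + r\<^sup>2 + r"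
    using fillval_mult_add a_eq by simp
  then show ?thesis
    by (simp add: a_eq b_eq power2_eq_square algebra_simps)
qed

lemma fillval_Suc:
  assumes "a > 0" "m \<le> a * a"
  shows "fillval (Suc a) m =
    fillval a m + 2 * min (m div a) (m mod a) * (a - max (m div a) (m mod a))"
proof -
  define q r where "q = m div a" and "r = m mod a"
  have m_eq: "m = q * a + r" and r_less: "r < a"
    using assms(1) by (simp_all add: q_def r_def)
  have "q \<le> a"
    using div_le_mono[OF assms(2), of a] assms(1) by (simp add: q_def)
  have fillval_eq: "fillval a m = q * a\<^sup>2 + a * q\<^sup>2 + 2 * q * r + r\<^sup>2 + r"
    using fillval_mult_add r_less by (simp add: m_eq)
  have "fillval (Suc a) m = fillval a m + 2 * min q r * (a - max q r)"
  proof (cases "q \<le> r")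
    case True
    obtain s d where r_eq: "r = q + s" and a_eq: "a = r + d"
      using True r_less by (metis le_Suc_ex less_imp_le)
    have "m = q * Suc a + s"
      by (simp add: m_eq r_eq)
    then have "fillval (Suc a) m = q * (Suc a)\<^sup>2 + Suc a * q\<^sup>2 + 2 * q * s + s\<^sup>2 + s"
      using fillval_mult_add[of s "Suc a" q] r_eq a_eq by simp
    then show ?thesis
      unfolding fillval_eq by (simp add: r_eq a_eq power2_eq_square algebra_simps)
  next
    case False
    obtain p d where q_eq: "q = r + Suc p" and a_eq: "a = q + d"
      using False \<open>q \<le> a\<close> by (metis le_Suc_ex less_imp_Suc_add add_Suc_right not_le)
    have "m = (r + p) * Suc a + Suc (r + d)"
      by (simp add: m_eq q_eq a_eq algebra_simps)
    then have "fillval (Suc a) m = (r + p) * (Suc a)\<^sup>2 + Suc a * (r + p)\<^sup>2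
        + 2 * (r + p) * Suc (r + d) + (Suc (r + d))\<^sup>2 + Suc (r + d)"
      using fillval_mult_add[of "Suc (r + d)" "Suc a" "r + p"] q_eq a_eq by simp
    then show ?thesis
      unfolding fillval_eq by (simp add: q_eq a_eq power2_eq_square algebra_simps)
  qed
  then show ?thesis
    by (simp add: q_def r_def)
qed

lemma fillval_mono:
  assumes "a > 0" "m \<le> a * a" "a \<le> b"
  shows "fillval a m \<le> fillval b m"
  using assms(3)
proof (induction b rule: dec_induct)
  case (step b)
  have "m \<le> b * b"
    using step.hyps(1) assms(2) by (meson le_trans mult_le_mono)
  then have "fillval b m \<le> fillval (Suc b) m"
    using fillval_Suc step.hyps(1) assms(1) by simp
  with step.IH show ?case
    by simp
qed simp

lemma fillval_less_Suc:
  assumes "a \<le> m" "m \<le> a * a" "\<not> a dvd m"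
  shows "fillval a m < fillval (Suc a) m"
proof -
  have "a > 0"
    using assms by (auto intro: gr0I)
  have "m < a * a"
    using assms(2,3) by (metis dvd_triv_left le_neq_implies_less)
  then have "m div a < a"
    by (simp add: less_mult_imp_div_less)
  moreover have "m div a > 0" "0 < m mod a" "m mod a < a"
    using assms \<open>a > 0\<close> by (simp_all add: div_greater_zero_iff mod_greater_zero_iff_not_dvd)
  ultimately show ?thesis
    using fillval_Suc[OF \<open>a > 0\<close> assms(2)] by simp
qed

lemma fillval_eq_imp_dvd:
  assumes "fillval x m = fillval k m" "m \<le> x * x" "k \<le> m" "x \<le> a" "a < k"
  shows "a dvd m"
proof (rule ccontr)
  assume "\<not> a dvd m"
  have "x > 0"
    using assms(2,3,5) by (auto intro: gr0I)
  have m_le: "m \<le> a * a"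
    using assms(2,4) by (meson le_trans mult_le_mono)
  have "fillval x m \<le> fillval a m"
    using \<open>x > 0\<close> assms by (intro fillval_mono)
  also have "\<dots> < fillval (Suc a) m"
    using \<open>\<not> a dvd m\<close> m_le assms by (intro fillval_less_Suc) auto
  also have "\<dots> \<le> fillval k m"
    using \<open>x > 0\<close> m_le assms by (intro fillval_mono) auto
  finally show False
    using assms(1) by simp
qed

definition tight_box :: "nat \<Rightarrow> nat \<Rightarrow> nat \<Rightarrow> bool" where
  "tight_box m k l \<longleftrightarrow> l \<le> k \<and> m \<le> k * l \<and> (k + 1) * (l - 1) < m"

lemma tight_box_pos:
  assumes "tight_box m k l"
  shows "0 < l" "l \<le> k"
  using assms by (auto simp: tight_box_def intro: gr0I)

lemma tight_box_deficit:
  assumes "tight_box m k l"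
  shows "k * l \<le> m + (k - l)"
proof -
  obtain d where "l = Suc d"
    using tight_box_pos[OF assms] gr0_implies_Suc by blast
  then show ?thesis
    using assms by (auto simp: tight_box_def)
qed

lemma tight_box_longest:
  assumes "tight_box m k l" "x + y = k + l" "m \<le> x * y"
  shows "x \<le> k"
proof (rule ccontr)
  assume "\<not> x \<le> k"
  then obtain s where x_eq: "x = k + 1 + s"
    using le_Suc_ex[of "k + 1" x] by auto
  then have l_eq: "l - 1 = y + s"
    using assms(2) by simp
  then have "y * s \<le> (k + 1) * s"
    using tight_box_pos[OF assms(1)] by (intro mult_le_mono1) simp
  then have "x * y \<le> (k + 1) * (l - 1)"
    unfolding x_eq l_eq by (simp add: algebra_simps)
  then show False
    using assms(1,3) by (simp add: tight_box_def)
qed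

lemma tight_box_pred_dvd_imp_eq:
  assumes tight: "tight_box m (Suc a) l" and "l < a" "a dvd m"
  shows "m = a * l"
proof -
  obtain q where m_eq: "m = a * q"
    using assms(3) by blast
  have "q = l"
  proof (cases q l rule: linorder_cases)
    case less
    then have "a * Suc q \<le> a * l"
      by (intro mult_le_mono2) simp
    then show ?thesis
      using tight_box_deficit[OF tight] tight_box_pos[OF tight] m_eq \<open>l < a\<close> by simp
  next
    case greater
    then have "a * Suc l \<le> a * q"
      by (intro mult_le_mono2) simp
    then show ?thesis
      using tight m_eq \<open>l < a\<close> by (simp add: tight_box_def)
  qed
  with m_eq show ?thesis
    by simp
qed

lemma fillval_eq_imp_pred:
  assumes eq: "fillval x m = fillval k m" and "x < k" "m \<le> x * x" "k \<le> m"
    and tight: "tight_box m k l" and "k + l \<le> 2 * x"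
  shows "Suc x = k \<and> m = x * l"
proof -
  obtain a where k_eq: "k = Suc a" "x \<le> a"
    using \<open>x < k\<close> by (cases k) auto
  have dvd: "c dvd m" if "x \<le> c" "c < k" for c
    using fillval_eq_imp_dvd[OF eq] that assms by simp
  have "0 < l" "l < a"
    using tight_box_pos[OF tight] assms(6) k_eq by linarith+
  then have m_eq: "m = a * l"
    using tight_box_pred_dvd_imp_eq tight dvd[of a] k_eq by simp
  have "x = a"
  proof (rule ccontr)
    assume "x \<noteq> a"
    then obtain c where a_eq: "a = Suc c" "x \<le> c"
      using k_eq(2) by (cases a) auto
    have "c dvd c * l + l"
      using dvd[of c] k_eq(1) a_eq m_eq by (simp add: add.commute)
    then have "c \<le> l"
      using \<open>0 < l\<close> dvd_imp_le by (metis dvd_add_right_iff dvd_triv_left)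
    then show False
      using assms(6) k_eq(1) a_eq by linarith
  qed
  then show ?thesis
    using k_eq m_eq by simp
qed

section \<open>Sums of squared degrees\<close>

definition row_sq :: "('a \<times> 'b) set \<Rightarrow> nat" where
  "row_sq R = (\<Sum>x\<in>Domain R. (card (R `` {x}))\<^sup>2)"

definition deg_sq :: "('a \<times> 'b) set \<Rightarrow> nat" where
  "deg_sq R = row_sq R + row_sq (R\<inverse>)"

lemma deg_sq_converse [simp]: "deg_sq (R\<inverse>) = deg_sq R"
  by (simp add: deg_sq_def)

lemma row_sq_eq_sum:
  assumes "finite X" "Domain R \<subseteq> X"
  shows "row_sq R = (\<Sum>x\<in>X. (card (R `` {x}))\<^sup>2)"
proof -
  have "R `` {x} = {}" if "x \<notin> Domain R" for x
    using that by blast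
  then show ?thesis
    unfolding row_sq_def using assms by (intro sum.mono_neutral_left) auto
qed

lemma card_eq_sum_Image:
  assumes "finite R" "finite X" "Domain R \<subseteq> X"
  shows "card R = (\<Sum>x\<in>X. card (R `` {x}))"
proof -
  have "R = Sigma X (\<lambda>x. R `` {x})"
    using assms(3) by auto
  then show ?thesis
    using assms by (metis card_SigmaI finite_Image finite.emptyI finite.insertI)
qed

lemma row_sq_eq_sum_edges:
  assumes "finite R"
  shows "row_sq R = (\<Sum>(x, y)\<in>R. card (R `` {x}))"
proof -
  have "row_sq R = (\<Sum>x\<in>Domain R. \<Sum>y\<in>R `` {x}. card (R `` {x}))"
    by (simp add: row_sq_def power2_eq_square)
  also have "\<dots> = (\<Sum>(x, y)\<in>(SIGMA x:Domain R. R `` {x}). card (R `` {x}))"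
    using assms by (intro sum.Sigma) (simp_all add: finite_Domain)
  also have "(SIGMA x:Domain R. R `` {x}) = R"
    by auto
  finally show ?thesis .
qed

lemma row_sq_insert:
  assumes "finite R" "(x, y) \<notin> R"
  shows "row_sq (insert (x, y) R) = row_sq R + 2 * card (R `` {x}) + 1"
proof -
  let ?S = "insert (x, y) R" and ?D = "insert x (Domain R)"
  have domain: "finite ?D" "Domain R \<subseteq> ?D" "Domain ?S \<subseteq> ?D"
    using assms(1) by (auto simp: finite_Domain)
  have "?S `` {x} = insert y (R `` {x})"
    by blast
  then have "card (?S `` {x}) = Suc (card (R `` {x}))"
    using assms by simp
  moreover have "?S `` {z} = R `` {z}" if "z \<noteq> x" for z
    using that by blast
  then have "(\<Sum>z\<in>?D - {x}. (card (?S `` {z}))\<^sup>2) = (\<Sum>z\<in>?D - {x}. (card (R `` {z}))\<^sup>2)"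
    by (intro sum.cong) auto
  ultimately show ?thesis
    unfolding row_sq_eq_sum[OF domain(1,2)] row_sq_eq_sum[OF domain(1,3)]
    using domain(1) by (simp add: sum.remove[of ?D x] power2_eq_square)
qed

lemma deg_sq_insert:
  assumes "finite R" "(x, y) \<notin> R"
  shows "deg_sq (insert (x, y) R) = deg_sq R + 2 * (card (R `` {x}) + card (R\<inverse> `` {y}) + 1)"
proof -
  have "(insert (x, y) R)\<inverse> = insert (y, x) (R\<inverse>)"
    by blast
  then show ?thesis
    using row_sq_insert[OF assms] row_sq_insert[of "R\<inverse>" y x] assms
    by (simp add: deg_sq_def)
qed

lemma row_sq_Un_column:
  assumes "finite R" "finite C" "Domain R \<subseteq> C" "y \<notin> Range R"
  shows "row_sq (R \<union> C \<times> {y}) = row_sq R + 2 * card R + card C"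
proof -
  let ?S = "R \<union> C \<times> {y}"
  have "(card (?S `` {x}))\<^sup>2 = (card (R `` {x}))\<^sup>2 + 2 * card (R `` {x}) + 1" if "x \<in> C" for x
  proof -
    have "?S `` {x} = insert y (R `` {x})" "y \<notin> R `` {x}"
      using that assms(4) by blast+
    then show ?thesis
      using assms(1) by (simp add: power2_eq_square)
  qed
  moreover have "row_sq ?S = (\<Sum>x\<in>C. (card (?S `` {x}))\<^sup>2)"
    using assms(2,3) by (intro row_sq_eq_sum) auto
  ultimately have "row_sq ?S = (\<Sum>x\<in>C. (card (R `` {x}))\<^sup>2 + 2 * card (R `` {x}) + 1)"
    by simp
  also have "\<dots> = row_sq R + 2 * card R + card C"
    unfolding row_sq_eq_sum[OF assms(2,3)] card_eq_sum_Image[OF assms(1-3)]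
    by (simp add: sum.distrib sum_distrib_left sum_Suc)
  finally show ?thesis .
qed

lemma row_sq_Un_row:
  assumes "finite R" "x \<notin> Domain R"
  shows "row_sq (R \<union> {x} \<times> C) = row_sq R + (card C)\<^sup>2"
proof -
  let ?S = "R \<union> {x} \<times> C" and ?X = "insert x (Domain R)"
  have "?S `` {x} = C" "R `` {x} = {}"
    using assms(2) by blast+
  moreover have "?S `` {z} = R `` {z}" if "z \<noteq> x" for z
    using that by blast
  then have "(\<Sum>z\<in>?X - {x}. (card (?S `` {z}))\<^sup>2) = (\<Sum>z\<in>?X - {x}. (card (R `` {z}))\<^sup>2)"
    by (intro sum.cong) auto
  moreover have "finite ?X" "Domain R \<subseteq> ?X" "Domain ?S \<subseteq> ?X"
    using assms(1) by (auto simp: finite_Domain)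
  ultimately show ?thesis
    by (simp add: row_sq_eq_sum[of ?X] sum.remove[of ?X x])
qed

lemma deg_sq_Un_column:
  assumes "finite R" "finite C" "Domain R \<subseteq> C" "y \<notin> Range R"
  shows "deg_sq (R \<union> C \<times> {y}) = deg_sq R + 2 * card R + card C + (card C)\<^sup>2"
proof -
  have "(R \<union> C \<times> {y})\<inverse> = R\<inverse> \<union> {y} \<times> C"
    by auto
  then show ?thesis
    using row_sq_Un_column[OF assms] row_sq_Un_row[of "R\<inverse>" y C] assms(1,4)
    by (simp add: deg_sq_def)
qed

lemma deg_sq_column:
  assumes "finite N"
  shows "deg_sq (N \<times> {y}) = card N * Suc (card N)"
  using deg_sq_Un_column[of "{}" N y] assms
  by (simp add: deg_sq_def row_sq_def power2_eq_square)

definition touching :: "('a \<times> 'b) set \<Rightarrow> 'a \<times> 'b \<Rightarrow> ('a \<times> 'b) set" where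
  "touching R e = {e' \<in> R. fst e' = fst e \<or> snd e' = snd e}"

lemma card_row_add_card_column:
  assumes "finite R" "(x, y) \<in> R"
  shows "card (R `` {x}) + card (R\<inverse> `` {y}) = Suc (card (touching R (x, y)))"
proof -
  let ?H = "{x} \<times> R `` {x}" and ?V = "R\<inverse> `` {y} \<times> {y}"
  have "?H \<union> ?V = touching R (x, y)" "?H \<inter> ?V = {(x, y)}"
    using assms(2) by (auto simp: touching_def)
  moreover have "card ?H + card ?V = card (?H \<union> ?V) + card (?H \<inter> ?V)"
    using assms(1) by (intro card_Un_Int) simp_all
  ultimately show ?thesis
    by (simp add: card_cartesian_product)
qed

lemma deg_sq_eq_sum_touching:
  assumes "finite R"
  shows "deg_sq R = (\<Sum>e\<in>R. Suc (card (touching R e)))"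
proof -
  have "row_sq (R\<inverse>) = (\<Sum>(y, x)\<in>R\<inverse>. card (R\<inverse> `` {y}))"
    using assms by (intro row_sq_eq_sum_edges) simp
  also have "\<dots> = (\<Sum>(x, y)\<in>R. card (R\<inverse> `` {y}))"
    by (rule sum.reindex_bij_witness[of _ prod.swap prod.swap]) auto
  finally show ?thesis
    using assms by (auto simp: deg_sq_def row_sq_eq_sum_edges card_row_add_card_column
        simp flip: sum.distrib intro!: sum.cong)
qed

lemma card_touching_le:
  assumes "finite R"
  shows "card (touching R e) \<le> card R"
  using assms by (auto simp: touching_def intro: card_mono)

lemma deg_sq_le_card_mult_Suc:
  assumes "finite R"
  shows "deg_sq R \<le> card R * Suc (card R)"
proof -
  have "deg_sq R \<le> (\<Sum>e\<in>R. Suc (card R))"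
    unfolding deg_sq_eq_sum_touching[OF assms]
    using card_touching_le[OF assms] by (intro sum_mono) simp
  then show ?thesis
    by simp
qed

lemma deg_sq_eq_imp_touching_eq:
  assumes "finite R" "deg_sq R = card R * Suc (card R)" "e \<in> R"
  shows "touching R e = R"
proof -
  have "(\<Sum>e\<in>R. Suc (card (touching R e))) = (\<Sum>e\<in>R. Suc (card R))"
    using assms(2) deg_sq_eq_sum_touching[OF assms(1)] by simp
  then have "Suc (card (touching R e)) = Suc (card R)"
    by (rule sum_mono_inv) (use assms card_touching_le in auto)
  then show ?thesis
    using assms(1) by (intro card_subset_eq) (auto simp: touching_def)
qed

lemma pairwise_touching_imp_star:
  assumes touching: "\<And>e. e \<in> R \<Longrightarrow> touching R e = R"
    and "R \<subseteq> X \<times> Y" "X \<noteq> {}" "Y \<noteq> {}"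
  obtains (column) N y where "N \<subseteq> X" "y \<in> Y" "R = N \<times> {y}"
    | (row) x N where "x \<in> X" "N \<subseteq> Y" "R = {x} \<times> N"
proof (cases "R = {}")
  case True
  then show thesis
    using column[of "{}"] assms(4) by auto
next
  case False
  then obtain x y where edge: "(x, y) \<in> R" "x \<in> X" "y \<in> Y"
    using assms(2) by auto
  have meet: "x' = x'' \<or> y' = y''" if "(x', y') \<in> R" "(x'', y'') \<in> R" for x' y' x'' y''
  proof -
    have "(x'', y'') \<in> touching R (x', y')"
      using touching[OF that(1)] that(2) by simp
    then show ?thesis
      by (auto simp: touching_def)
  qed
  show thesis
  proof (cases "Range R \<subseteq> {y}")
    case True
    then have "R = Domain R \<times> {y}"
      by auto
    then show thesis
      using column[of "Domain R" y] assms(2) edge by auto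
  next
    case False
    then obtain x' y' where "(x', y') \<in> R" "y' \<noteq> y"
      by auto
    then have "x'' = x" if "(x'', y'') \<in> R" for x'' y''
      using meet edge(1) that by metis
    then have "R = {x} \<times> Range R"
      by auto
    then show thesis
      using row[of x "Range R"] assms(2) edge by auto
  qed
qed

section \<open>The upper bound\<close>

text \<open>
  The bipartite graph contains no induced \<open>2K\<^sub>2\<close>; this form of nestedness is visibly symmetric in
  the two parts.
\<close>

definition nested :: "('a \<times> 'b) set \<Rightarrow> bool" where
  "nested R \<longleftrightarrow> (\<forall>x y x' y'. (x, y) \<in> R \<longrightarrow> (x', y') \<in> R \<longrightarrow> (x, y') \<in> R \<or> (x', y) \<in> R)"

lemma nested_converse: "nested R \<Longrightarrow> nested (R\<inverse>)"
  unfolding nested_def by (metis converse_iff)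

lemma nested_obtain_dominating_column:
  assumes "nested R" "finite R" "R \<noteq> {}"
  obtains y where "R\<inverse> `` {y} = Domain R"
proof -
  let ?columns = "(\<lambda>y. R\<inverse> `` {y}) ` Range R"
  have "finite ?columns" "?columns \<noteq> {}"
    using assms(2,3) by (auto simp: finite_Range)
  from finite_has_maximal[OF this] obtain y
    where maximal: "\<And>z. z \<in> Range R \<Longrightarrow> R\<inverse> `` {y} \<subseteq> R\<inverse> `` {z} \<Longrightarrow> R\<inverse> `` {y} = R\<inverse> `` {z}"
    by auto
  have "(x, y) \<in> R" if "(x, z) \<in> R" for x z
  proof (rule ccontr)
    assume "(x, y) \<notin> R"
    then have "R\<inverse> `` {y} \<subseteq> R\<inverse> `` {z}"
      using assms(1) that unfolding nested_def by blast
    then have "R\<inverse> `` {y} = R\<inverse> `` {z}"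
      using maximal that by (metis RangeI)
    then show False
      using that \<open>(x, y) \<notin> R\<close> by blast
  qed
  then have "R\<inverse> `` {y} = Domain R"
    by blast
  then show thesis
    by (rule that)
qed

lemma nested_obtain_deleted_column:
  fixes R :: "('a \<times> 'b) set"
  assumes "nested R" "finite R" "R \<noteq> {}"
  obtains S :: "('a \<times> 'b) set" where "nested S" "finite S"
    "Domain S \<subseteq> Domain R" "Range S \<subseteq> Range R" "card R = card (Domain R) + card S"
    "deg_sq R = deg_sq S + 2 * card S + card (Domain R) + (card (Domain R))\<^sup>2"
proof -
  obtain y where dominating: "R\<inverse> `` {y} = Domain R"
    using nested_obtain_dominating_column[OF assms] .
  define S where "S = {(x, z) \<in> R. z \<noteq> y}"
  have R_eq: "R = S \<union> Domain R \<times> {y}" and disj: "S \<inter> Domain R \<times> {y} = {}"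
    using dominating by (auto simp: S_def)
  have S_props: "finite S" "Domain S \<subseteq> Domain R" "Range S \<subseteq> Range R" "y \<notin> Range S"
    using assms(2) by (auto simp: S_def intro: finite_subset[of _ R])
  show thesis
  proof (rule that)
    show "nested S"
      using assms(1) unfolding S_def nested_def by blast
    have "card R = card S + card (Domain R \<times> {y})"
      using card_Un_disjoint[OF S_props(1) _ disj] R_eq assms(2) by (simp add: finite_Domain)
    then show "card R = card (Domain R) + card S"
      by (simp add: card_cartesian_product)
    show "deg_sq R = deg_sq S + 2 * card S + card (Domain R) + (card (Domain R))\<^sup>2"
      using deg_sq_Un_column[of S "Domain R" y] S_props assms(2) R_eq by (simp add: finite_Domain)
  qed (use S_props in auto)
qed

lemma nested_obtain_deleted_line:
  fixes R :: "('a \<times> 'b) set"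
  assumes "nested R" "finite R" "R \<noteq> {}"
  defines "c \<equiv> max (card (Domain R)) (card (Range R))"
  obtains S :: "('a \<times> 'b) set" where "nested S" "finite S"
    "card (Domain S) \<le> c" "card (Range S) \<le> c" "card R = c + card S"
    "deg_sq R = deg_sq S + 2 * card S + c + c\<^sup>2"
proof (cases "card (Range R) \<le> card (Domain R)")
  case True
  then have c_eq: "c = card (Domain R)"
    by (simp add: c_def)
  obtain S where S_props: "nested S" "finite S" "Domain S \<subseteq> Domain R" "Range S \<subseteq> Range R"
    "card R = c + card S" "deg_sq R = deg_sq S + 2 * card S + c + c\<^sup>2"
    using nested_obtain_deleted_column[OF assms(1-3)] unfolding c_eq .
  moreover have "card (Domain S) \<le> card (Domain R)" "card (Range S) \<le> card (Range R)"
    using S_props assms(2) by (simp_all add: card_mono finite_Domain finite_Range)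
  ultimately show thesis
    using that[of S] c_eq True by simp
next
  case False
  then have c_eq: "c = card (Domain (R\<inverse>))"
    by (simp add: c_def)
  have "nested (R\<inverse>)" "finite (R\<inverse>)" "R\<inverse> \<noteq> {}"
    using assms(1-3) by (auto simp: nested_converse)
  then obtain S where S_props: "nested S" "finite S" "Domain S \<subseteq> Range R" "Range S \<subseteq> Domain R"
    "card R = c + card S" "deg_sq R = deg_sq S + 2 * card S + c + c\<^sup>2"
    using nested_obtain_deleted_column[of "R\<inverse>"] unfolding c_eq by auto
  moreover have "card (Domain S) \<le> card (Range R)" "card (Range S) \<le> card (Domain R)"
    using S_props assms(2) by (simp_all add: card_mono finite_Domain finite_Range)
  ultimately show thesis
    using that[of "S\<inverse>"] c_eq False by (simp add: nested_converse)
qed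

lemma card_le_Domain_times_Range:
  assumes "finite R"
  shows "card R \<le> card (Domain R) * card (Range R)"
proof -
  have "card R \<le> card (Domain R \<times> Range R)"
    using assms by (intro card_mono) (auto simp: finite_Domain finite_Range)
  then show ?thesis
    by (simp add: card_cartesian_product)
qed

lemma nested_deg_sq_le_fillval:
  fixes R :: "('a \<times> 'b) set"
  assumes "nested R" "finite R" "card (Domain R) \<le> a" "card (Range R) \<le> a"
  shows "deg_sq R \<le> fillval a (card R)"
  using assms
proof (induction "card R" arbitrary: R a rule: less_induct)
  case less
  show ?case
  proof (cases "R = {}")
    case True
    then show ?thesis
      by (simp add: deg_sq_def row_sq_def)
  next
    case False
    define c where "c = max (card (Domain R)) (card (Range R))"
    obtain S :: "('a \<times> 'b) set" where S_props: "nested S" "finite S"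
      "card (Domain S) \<le> c" "card (Range S) \<le> c" "card R = c + card S"
      "deg_sq R = deg_sq S + 2 * card S + c + c\<^sup>2"
      using nested_obtain_deleted_line[OF less.prems(1,2) False] unfolding c_def .
    have "0 < c" "c \<le> a"
      using less.prems False by (auto simp: c_def less_max_iff_disj card_gt_0_iff finite_Domain)
    have "deg_sq S \<le> fillval c (card S)"
      using S_props \<open>0 < c\<close> by (intro less.hyps) simp_all
    then have "deg_sq R \<le> fillval c (card R)"
      using S_props fillval_add_self[OF \<open>0 < c\<close>] by simp
    also have "card (Domain R) * card (Range R) \<le> c * c"
      by (intro mult_le_mono) (simp_all add: c_def)
    then have "fillval c (card R) \<le> fillval a (card R)"
      using \<open>0 < c\<close> \<open>c \<le> a\<close> card_le_Domain_times_Range[OF less.prems(2)]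
      by (intro fillval_mono) auto
    finally show ?thesis .
  qed
qed

lemma deg_sq_shift_less:
  assumes "finite R" "(x', y) \<in> R" "(x, y) \<notin> R" "card (R `` {x'}) \<le> card (R `` {x})"
  shows "deg_sq R < deg_sq (insert (x, y) (R - {(x', y)}))"
proof -
  obtain S where R_eq: "R = insert (x', y) S" and edge_removed: "(x', y) \<notin> S"
    using assms(2) by (meson mk_disjoint_insert)
  have "finite S" "(x, y) \<notin> S" "x \<noteq> x'"
    using assms(1,3) by (auto simp: R_eq)
  have "R `` {x'} = insert y (S `` {x'})" "R `` {x} = S `` {x}"
    using \<open>x \<noteq> x'\<close> by (auto simp: R_eq)
  then have "card (S `` {x'}) < card (S `` {x})"
    using assms(4) edge_removed \<open>finite S\<close> by simp
  then have "deg_sq R < deg_sq (insert (x, y) S)"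
    unfolding R_eq using edge_removed \<open>finite S\<close> \<open>(x, y) \<notin> S\<close> by (simp add: deg_sq_insert)
  then show ?thesis
    using edge_removed by (simp add: R_eq)
qed

lemma nested_if_deg_sq_maximal:
  assumes "finite R" "R \<subseteq> X \<times> Y"
    and max: "\<And>S. S \<subseteq> X \<times> Y \<Longrightarrow> card S = card R \<Longrightarrow> deg_sq S \<le> deg_sq R"
  shows "nested R"
proof (rule ccontr)
  assume "\<not> nested R"
  then obtain x y x' y' where edges: "(x, y) \<in> R" "(x', y') \<in> R"
    and non_edges: "(x, y') \<notin> R" "(x', y) \<notin> R"
    unfolding nested_def by blast
  have "card (R `` {v}) < card (R `` {u})" if "(u, z) \<in> R" "(v, z) \<notin> R" "v \<in> X" for u v z
  proof (rule ccontr)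
    assume "\<not> ?thesis"
    moreover have "insert (v, z) (R - {(u, z)}) \<subseteq> X \<times> Y"
      using that assms(2) by auto
    moreover have "card (insert (v, z) (R - {(u, z)})) = card R"
      using that assms(1) by (simp add: card_Suc_Diff1 del: card_Diff_insert)
    ultimately show False
      using deg_sq_shift_less[OF assms(1) that(1,2)] max by (meson leD not_le)
  qed
  from this[OF edges(1) non_edges(2)] this[OF edges(2) non_edges(1)] show False
    using edges assms(2) by fastforce
qed

lemma deg_sq_le_fillval:
  assumes "finite X" "finite Y" "R \<subseteq> X \<times> Y" "card X \<le> a" "card Y \<le> a"
  shows "deg_sq R \<le> fillval a (card R)"
proof -
  let ?P = "\<lambda>S. S \<subseteq> X \<times> Y \<and> card S = card R"
  have fin: "finite S" if "S \<subseteq> X \<times> Y" for S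
    using that assms(1,2) finite_subset by blast
  have "\<forall>S. ?P S \<longrightarrow> deg_sq S < Suc (card R * Suc (card R))"
    using deg_sq_le_card_mult_Suc[OF fin] by (simp only: less_Suc_eq_le) metis
  then have "\<exists>S. ?P S \<and> (\<forall>T. ?P T \<longrightarrow> deg_sq T \<le> deg_sq S)"
    using assms(3) by (intro ex_has_greatest_nat[of ?P R]) simp_all
  then obtain S where "?P S" and max: "\<forall>T. ?P T \<longrightarrow> deg_sq T \<le> deg_sq S"
    by metis
  then have S_props: "S \<subseteq> X \<times> Y" "card S = card R"
    by simp_all
  have "nested S"
    using nested_if_deg_sq_maximal[OF fin[OF S_props(1)] S_props(1)] max S_props(2) by simp
  moreover have "Domain S \<subseteq> X" "Range S \<subseteq> Y"
    using S_props(1) by auto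
  then have "card (Domain S) \<le> card X" "card (Range S) \<le> card Y"
    using assms(1,2) by (simp_all add: card_mono)
  ultimately have "deg_sq S \<le> fillval a (card S)"
    using fin[OF S_props(1)] assms(4,5) by (intro nested_deg_sq_le_fillval) simp_all
  then show ?thesis
    using max assms(3) S_props(2) by (metis le_trans)
qed

section \<open>Bipartite complements\<close>

lemma row_sq_Times_Diff:
  assumes "finite X" "finite Y" "R \<subseteq> X \<times> Y"
  shows "row_sq (X \<times> Y - R) + 2 * card Y * card R = row_sq R + card X * (card Y)\<^sup>2"
proof -
  let ?T = "X \<times> Y - R"
  have finR: "finite R" and domain: "Domain R \<subseteq> X" "Domain ?T \<subseteq> X"
    using assms by (auto intro: finite_subset)
  have "(card (?T `` {x}))\<^sup>2 + 2 * card Y * card (R `` {x}) = (card (R `` {x}))\<^sup>2 + (card Y)\<^sup>2"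
    if "x \<in> X" for x
  proof -
    have "?T `` {x} = Y - R `` {x}" "R `` {x} \<subseteq> Y"
      using that assms(3) by blast+
    then have "card Y = card (?T `` {x}) + card (R `` {x})"
      using assms(2) finR by (simp add: card_Diff_subset card_mono)
    then show ?thesis
      by (simp add: power2_eq_square algebra_simps)
  qed
  then have "(\<Sum>x\<in>X. (card (?T `` {x}))\<^sup>2 + 2 * card Y * card (R `` {x}))
      = (\<Sum>x\<in>X. (card (R `` {x}))\<^sup>2 + (card Y)\<^sup>2)"
    by (rule sum.cong[OF refl])
  then show ?thesis
    unfolding row_sq_eq_sum[OF assms(1) domain(1)] row_sq_eq_sum[OF assms(1) domain(2)]
      card_eq_sum_Image[OF finR assms(1) domain(1)]
    by (simp add: sum.distrib sum_distrib_left)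
qed

lemma deg_sq_Times_Diff:
  assumes "finite X" "finite Y" "R \<subseteq> X \<times> Y"
  shows "deg_sq (X \<times> Y - R) + 2 * (card X + card Y) * card R
    = deg_sq R + card X * card Y * (card X + card Y)"
proof -
  have "(X \<times> Y - R)\<inverse> = Y \<times> X - R\<inverse>" "R\<inverse> \<subseteq> Y \<times> X"
    using assms(3) by auto
  then show ?thesis
    using row_sq_Times_Diff[OF assms] row_sq_Times_Diff[of Y X "R\<inverse>"] assms(1,2)
    by (simp add: deg_sq_def power2_eq_square algebra_simps)
qed

lemma card_Times_Diff:
  assumes "finite X" "finite Y" "T \<subseteq> X \<times> Y"
  shows "card (X \<times> Y - T) + card T = card X * card Y"
proof -
  have "finite T"
    using assms finite_subset by blast
  then show ?thesis
    using assms card_mono[OF _ assms(3)] by (simp add: card_Diff_subset card_cartesian_product)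
qed

lemma deg_sq_Times_Diff_eq_fillval_iff:
  assumes "finite X" "finite Y" "T \<subseteq> X \<times> Y" "card T \<le> card X" "Y \<noteq> {}"
  shows "deg_sq (X \<times> Y - T) = fillval (card X) (card (X \<times> Y - T))
    \<longleftrightarrow> deg_sq T = card T * Suc (card T)"
proof -
  have "fillval (card X) (card (X \<times> Y - T)) + 2 * (card X + card Y) * card T
      = card X * card Y * (card X + card Y) + (card T)\<^sup>2 + card T"
    using card_Times_Diff[OF assms(1-3)] assms(2,4,5)
    by (intro fillval_deficit) (simp_all add: card_gt_0_iff)
  then show ?thesis
    using deg_sq_Times_Diff[OF assms(1-3)] by (simp add: power2_eq_square) linarith
qed

section \<open>Bipartite graphs as relations\<close>

definition graph_of :: "'a set \<Rightarrow> 'a set \<Rightarrow> ('a \<times> 'a) set \<Rightarrow> 'a ugraph" where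
  "graph_of X Y R = \<lparr>verts = X \<union> Y, edges = (\<lambda>(x, y). {x, y}) ` R\<rparr>"

lemma verts_graph_of [simp]: "verts (graph_of X Y R) = X \<union> Y"
  by (simp add: graph_of_def)

lemma doubleton_in_edges_graph_of_iff:
  "{u, v} \<in> edges (graph_of X Y R) \<longleftrightarrow> (u, v) \<in> R \<or> (v, u) \<in> R"
  by (auto simp: graph_of_def doubleton_eq_iff image_iff)

lemma graph_of_converse: "graph_of Y X (R\<inverse>) = graph_of X Y R"
  by (force simp: graph_of_def insert_commute Un_commute)

lemma card_edges_graph_of:
  assumes "X \<inter> Y = {}" "R \<subseteq> X \<times> Y"
  shows "card (edges (graph_of X Y R)) = card R"
proof -
  have "(y, x) \<notin> R" if "(x, y) \<in> R" for x y
    using assms that by blast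
  then have "inj_on (\<lambda>(x, y). {x, y}) R"
    by (intro inj_onI) (auto simp: doubleton_eq_iff)
  then show ?thesis
    by (simp add: graph_of_def card_image)
qed

lemma degree_graph_of:
  assumes "X \<inter> Y = {}" "R \<subseteq> X \<times> Y" "x \<in> X"
  shows "degree (graph_of X Y R) x = card (R `` {x})"
proof -
  have "{e \<in> edges (graph_of X Y R). x \<in> e} = (\<lambda>y. {x, y}) ` (R `` {x})"
    using assms by (fastforce simp: graph_of_def)
  moreover have "inj_on (\<lambda>y. {x, y}) (R `` {x})"
    by (auto simp: inj_on_def doubleton_eq_iff)
  ultimately show ?thesis
    by (simp add: degree_def card_image)
qed

lemma sigma2_graph_of:
  assumes "finite X" "finite Y" "X \<inter> Y = {}" "R \<subseteq> X \<times> Y"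
  shows "sigma2 (graph_of X Y R) = deg_sq R"
proof -
  have rows: "(\<Sum>x\<in>X. (degree (graph_of X Y R) x)\<^sup>2) = row_sq R"
    if "finite X" "X \<inter> Y = {}" "R \<subseteq> X \<times> Y" for X Y :: "'a set" and R
  proof -
    have "row_sq R = (\<Sum>x\<in>X. (card (R `` {x}))\<^sup>2)"
      using that by (intro row_sq_eq_sum) auto
    then show ?thesis
      using degree_graph_of[OF that(2,3)] by simp
  qed
  have "(\<Sum>y\<in>Y. (degree (graph_of X Y R) y)\<^sup>2) = row_sq (R\<inverse>)"
    using rows[of Y X "R\<inverse>"] assms by (auto simp: graph_of_converse)
  then show ?thesis
    using rows[OF assms(1,3,4)] assms(1-3)
    by (simp add: sigma2_def deg_sq_def sum.union_disjoint)
qed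

lemma graph_of_in_bipartite_graphs:
  assumes "finite X" "finite Y" "X \<inter> Y = {}" "R \<subseteq> X \<times> Y"
  shows "graph_of X Y R \<in> bipartite_graphs (card X + card Y) (card R)"
proof -
  have "bipartition (graph_of X Y R) X Y"
    using assms unfolding bipartition_def graph_of_def by fastforce
  moreover have "simple_graph (graph_of X Y R)"
    using assms unfolding simple_graph_def graph_of_def by (fastforce simp: card_2_iff)
  ultimately show ?thesis
    using assms card_edges_graph_of[OF assms(3,4)]
    by (auto simp: bipartite_graphs_def bipartite_def card_Un_disjoint)
qed

lemma bipartition_imp_eq_graph_of:
  assumes "bipartition G X Y"
  shows "G = graph_of X Y {(x, y) \<in> X \<times> Y. {x, y} \<in> edges G}"
proof -
  have "edges G = (\<lambda>(x, y). {x, y}) ` {(x, y) \<in> X \<times> Y. {x, y} \<in> edges G}"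
    using assms unfolding bipartition_def by fastforce
  moreover have "verts G = X \<union> Y"
    using assms by (simp add: bipartition_def)
  ultimately show ?thesis
    by (simp add: graph_of_def)
qed

lemma bipartite_graphs_obtain_graph_of:
  assumes "B \<in> bipartite_graphs n m"
  obtains X Y R where "B = graph_of X Y R" "finite X" "finite Y" "X \<inter> Y = {}" "R \<subseteq> X \<times> Y"
    "card R = m" "card X + card Y = n" "card Y \<le> card X"
proof -
  obtain X\<^sub>0 Y\<^sub>0 where "bipartition B X\<^sub>0 Y\<^sub>0"
    using assms unfolding bipartite_graphs_def bipartite_def by blast
  moreover from this have "bipartition B Y\<^sub>0 X\<^sub>0"
    unfolding bipartition_def by (metis Un_commute Int_commute insert_commute)
  ultimately obtain X Y where parts: "bipartition B X Y" "card Y \<le> card X"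
    using nat_le_linear by metis
  define R where "R = {(x, y) \<in> X \<times> Y. {x, y} \<in> edges B}"
  have B_eq: "B = graph_of X Y R" "R \<subseteq> X \<times> Y"
    using bipartition_imp_eq_graph_of[OF parts(1)] by (auto simp: R_def)
  have disj: "X \<inter> Y = {}"
    using parts(1) by (simp add: bipartition_def)
  moreover have "finite (X \<union> Y)" "card (X \<union> Y) = n" "card (edges (graph_of X Y R)) = m"
    using assms B_eq(1) by (simp_all add: bipartite_graphs_def simple_graph_def)
  ultimately show thesis
    using that[OF B_eq(1) _ _ disj B_eq(2)] parts(2) card_edges_graph_of[OF disj B_eq(2)]
    by (simp add: card_Un_disjoint)
qed

lemma graph_of_isoI:
  assumes "bij_betw f X X'" "bij_betw g Y Y'" and disj: "X \<inter> Y = {}" "X' \<inter> Y' = {}"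
    and R_sub: "R \<subseteq> X \<times> Y" "R' \<subseteq> X' \<times> Y'"
    and iff: "\<And>x y. x \<in> X \<Longrightarrow> y \<in> Y \<Longrightarrow> (x, y) \<in> R \<longleftrightarrow> (f x, g y) \<in> R'"
  shows "graph_of X Y R \<simeq> graph_of X' Y' R'"
proof -
  define h where "h = (\<lambda>z. if z \<in> X then f z else g z)"
  have bij: "bij_betw h (X \<union> Y) (X' \<union> Y')"
    unfolding h_def using assms by (intro bij_betw_disjoint_Un)
  have "f x \<in> X'" if "x \<in> X" for x
    using assms(1) that by (rule bij_betwE[THEN bspec])
  moreover have "g y \<in> Y'" if "y \<in> Y" for y
    using assms(2) that by (rule bij_betwE[THEN bspec])
  ultimately have h_in: "h u \<in> X' \<longleftrightarrow> u \<in> X" if "u \<in> X \<union> Y" for u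
    using that disj by (auto simp: h_def)
  have "(u, v) \<in> R \<longleftrightarrow> (h u, h v) \<in> R'" if "u \<in> X \<union> Y" "v \<in> X \<union> Y" for u v
  proof (cases "u \<in> X \<and> v \<in> Y")
    case True
    then have "h u = f u" "h v = g v"
      using disj by (auto simp: h_def)
    with True show ?thesis
      by (simp add: iff)
  next
    case False
    then have "h u \<notin> X' \<or> h v \<in> X'"
      using h_in that by auto
    then have "(h u, h v) \<notin> R'"
      using R_sub(2) disj(2) by auto
    moreover have "(u, v) \<notin> R"
      using False R_sub(1) by auto
    ultimately show ?thesis
      by simp
  qed
  then show ?thesis
    unfolding graph_iso_def using bij by (auto simp: doubleton_in_edges_graph_of_iff)
qed

lemma less_iff_div_mod_lex:
  fixes m n k :: nat
  shows "m < n \<longleftrightarrow> m div k < n div k \<or> m div k = n div k \<and> m mod k < n mod k"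
proof (cases "m div k" "n div k" rule: linorder_cases)
  case less
  then have "m < n"
    by (metis div_le_mono leD not_le)
  with less show ?thesis
    by simp
next
  case equal
  then show ?thesis
    by (metis div_mult_mod_eq add_less_cancel_left less_irrefl)
next
  case greater
  then have "n < m"
    by (metis div_le_mono leD not_le)
  with greater show ?thesis
    by simp
qed

lemma Bl_eq_graph_of:
  "Bl n m k = graph_of (Inl ` {..<k}) (Inr ` {..<n - k})
    {(Inl i, Inr j) | i j. i < k \<and> j < n - k \<and> j * k + i < m}"
proof -
  have "i < k \<and> j < n - k \<and> (j < m div k \<or> j = m div k \<and> i < m mod k)
      \<longleftrightarrow> i < k \<and> j < n - k \<and> j * k + i < m" for i j
    using less_iff_div_mod_lex[of "j * k + i" m k] by auto
  then have "edges (Bl n m k) = {{Inl i, Inr j} | i j. i < k \<and> j < n - k \<and> j * k + i < m}"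
    by (simp add: Bl_def Let_def)
  also have "\<dots> = (\<lambda>(x, y). {x, y}) ` {(Inl i, Inr j) | i j. i < k \<and> j < n - k \<and> j * k + i < m}"
    by force
  finally show ?thesis
    by (simp add: graph_of_def Bl_def Let_def)
qed

lemma obtain_bij_betw_lessThan_final_segment:
  assumes "finite A" "S \<subseteq> A"
  obtains f where "bij_betw f A {..<card A}" "{a \<in> A. card A \<le> f a + card S} = S"
proof -
  define c where "c = card A - card S"
  have fin: "finite (A - S)" "finite S"
    using assms finite_subset by auto
  have card_eqs: "card (A - S) = c" "card A = c + card S"
    using assms fin by (simp_all add: c_def card_Diff_subset card_mono)
  then have "card (A - S) = card {..<c}" "card S = card {c..<card A}"
    by simp_all
  then obtain g h where g_bij: "bij_betw g (A - S) {..<c}" and h_bij: "bij_betw h S {c..<card A}"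
    using fin by (meson finite_same_card_bij finite_lessThan finite_atLeastLessThan)
  define f where "f = (\<lambda>a. if a \<in> A - S then g a else h a)"
  have "bij_betw f ((A - S) \<union> S) ({..<c} \<union> {c..<card A})"
    unfolding f_def using g_bij h_bij by (intro bij_betw_disjoint_Un) auto
  moreover have "(A - S) \<union> S = A" "{..<c} \<union> {c..<card A} = {..<card A}"
    using assms(2) card_eqs(2) by auto
  ultimately have "bij_betw f A {..<card A}"
    by simp
  moreover have "a \<in> S \<longleftrightarrow> c \<le> f a" if "a \<in> A" for a
    using that bij_betwE[OF g_bij] bij_betwE[OF h_bij] by (cases "a \<in> S") (auto simp: f_def not_le)
  then have "{a \<in> A. card A \<le> f a + card S} = S"
    using assms(2) card_eqs(2) by auto
  ultimately show thesis
    by (rule that)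
qed

lemma mult_add_less_deficit_iff:
  fixes a b i j m t :: nat
  assumes "m + t = a * b" "t \<le> a" "i < a" "j < b"
  shows "j * a + i < m \<longleftrightarrow> \<not> (Suc j = b \<and> a \<le> i + t)"
proof (cases "Suc j = b")
  case True
  then have "m + t = j * a + a"
    using assms(1) by auto
  then show ?thesis
    using True by auto
next
  case False
  then have "Suc (Suc j) * a \<le> b * a"
    using assms(4) by (intro mult_le_mono1) simp
  then show ?thesis
    using False assms(1-3) by (simp add: mult.commute[of a])
qed

lemma Times_Diff_column_iso_Bl:
  assumes fin: "finite X" "finite Y" and disj: "X \<inter> Y = {}" and "N \<subseteq> X" "y \<in> Y"
    and m_eq: "m + card N = card X * card Y"
  shows "graph_of X Y (X \<times> Y - N \<times> {y}) \<simeq> Bl (card X + card Y) m (card X)"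
proof -
  obtain f where f_props: "bij_betw f X {..<card X}" "{x \<in> X. card X \<le> f x + card N} = N"
    using obtain_bij_betw_lessThan_final_segment[OF fin(1) \<open>N \<subseteq> X\<close>] .
  obtain g where g_props: "bij_betw g Y {..<card Y}" "{z \<in> Y. card Y \<le> g z + card {y}} = {y}"
    using obtain_bij_betw_lessThan_final_segment[OF fin(2), of "{y}"] \<open>y \<in> Y\<close> by blast
  have "card N \<le> card X"
    using fin(1) \<open>N \<subseteq> X\<close> by (simp add: card_mono)
  have edges: "(x, z) \<in> X \<times> Y - N \<times> {y} \<longleftrightarrow> g z * card X + f x < m" if "x \<in> X" "z \<in> Y" for x z
  proof -
    have less: "f x < card X" "g z < card Y"
      using that bij_betwE[OF f_props(1)] bij_betwE[OF g_props(1)] by auto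
    have "z \<in> {y} \<longleftrightarrow> card Y \<le> g z + card {y}"
      using g_props(2) that(2) by blast
    then have "z = y \<longleftrightarrow> Suc (g z) = card Y"
      using less(2) by auto
    moreover have "x \<in> N \<longleftrightarrow> card X \<le> f x + card N"
      using f_props(2) that(1) by blast
    ultimately show ?thesis
      using mult_add_less_deficit_iff[OF m_eq \<open>card N \<le> card X\<close> less] that by auto
  qed
  have "bij_betw (Inl \<circ> f) X (Inl ` {..<card X} :: (nat + nat) set)"
    by (rule bij_betw_trans[OF f_props(1)]) (simp add: bij_betw_def)
  moreover have "bij_betw (Inr \<circ> g) Y (Inr ` {..<card Y} :: (nat + nat) set)"
    by (rule bij_betw_trans[OF g_props(1)]) (simp add: bij_betw_def)
  ultimately show ?thesis
    unfolding Bl_eq_graph_of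
    using disj edges bij_betwE[OF f_props(1)] bij_betwE[OF g_props(1)] by (intro graph_of_isoI) auto
qed

section \<open>Extremal graphs\<close>

lemma obtain_bipartite_graph_sigma2_eq_fillval:
  fixes V :: "'a set"
  assumes "finite V" "card V = k + l" "l > 0" "m + t = k * l" "t \<le> k"
  obtains H :: "'a ugraph" where "H \<in> bipartite_graphs (k + l) m" "sigma2 H = fillval k m"
proof -
  obtain X where X_props: "X \<subseteq> V" "card X = k" "finite X"
    using obtain_subset_with_card_n[of k V] assms(2) by auto
  define Y where "Y = V - X"
  have Y_props: "finite Y" "card Y = l" "X \<inter> Y = {}"
    using X_props assms(1,2) by (auto simp: Y_def card_Diff_subset)
  then have "Y \<noteq> {}"
    using \<open>l > 0\<close> by auto
  then obtain y where "y \<in> Y"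
    by blast
  obtain N where N_props: "N \<subseteq> X" "card N = t" "finite N"
    using obtain_subset_with_card_n[of t X] assms(5) X_props by auto
  define R where "R = X \<times> Y - N \<times> {y}"
  have sub: "N \<times> {y} \<subseteq> X \<times> Y"
    using N_props(1) \<open>y \<in> Y\<close> by auto
  have "card R = m"
    using card_Times_Diff[OF X_props(3) Y_props(1) sub] assms(4) X_props N_props Y_props
    by (simp add: R_def card_cartesian_product)
  moreover have "deg_sq R = fillval (card X) (card R)"
    unfolding R_def
    using deg_sq_Times_Diff_eq_fillval_iff[OF X_props(3) Y_props(1) sub] deg_sq_column[OF N_props(3)]
      \<open>Y \<noteq> {}\<close> assms(5) X_props N_props by (simp add: card_cartesian_product)
  ultimately show thesis
    using that[of "graph_of X Y R"] graph_of_in_bipartite_graphs[of X Y R] sigma2_graph_of[of X Y R]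
      X_props Y_props by (auto simp: R_def)
qed

lemma deg_sq_eq_fillval_imp_iso_Bl:
  assumes fin: "finite X" "finite Y" and disj: "X \<inter> Y = {}" and R_sub: "R \<subseteq> X \<times> Y"
    and "X \<noteq> {}" "Y \<noteq> {}" and full: "card X * card Y \<le> card R + card X"
    and eq: "deg_sq R = fillval (card X) (card R)"
  shows "graph_of X Y R \<simeq> Bl (card X + card Y) (card R) (card X) \<or>
    graph_of X Y R \<simeq> Bl (card X + card Y) (card R) (card Y) \<and> (card X - 1) * card Y \<le> card R"
proof -
  define T where "T = X \<times> Y - R"
  have T_props: "T \<subseteq> X \<times> Y" "finite T" and R_eq: "R = X \<times> Y - T"
    using R_sub fin by (auto simp: T_def)
  have card_R_T: "card R + card T = card X * card Y"
    using card_Times_Diff[OF fin T_props(1)] R_eq by simp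
  then have "deg_sq T = card T * Suc (card T)"
    using deg_sq_Times_Diff_eq_fillval_iff[OF fin T_props(1)] R_eq eq full \<open>Y \<noteq> {}\<close> by simp
  note touching = deg_sq_eq_imp_touching_eq[OF T_props(2) this]
  consider (column) N y where "N \<subseteq> X" "y \<in> Y" "T = N \<times> {y}"
    | (row) x N where "x \<in> X" "N \<subseteq> Y" "T = {x} \<times> N"
    using pairwise_touching_imp_star[OF touching T_props(1) assms(5,6)] by metis
  then show ?thesis
  proof cases
    case column
    then have "card R + card N = card X * card Y"
      using card_R_T by (simp add: card_cartesian_product)
    then show ?thesis
      using Times_Diff_column_iso_Bl[OF fin disj column(1,2)] column(3) R_eq by simp
  next
    case row
    then have card_N: "card N = card T"
      by (simp add: card_cartesian_product)
    have "R\<inverse> = Y \<times> X - N \<times> {x}"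
      using row R_eq by auto
    then have "graph_of Y X (R\<inverse>) \<simeq> Bl (card Y + card X) (card R) (card Y)"
      using Times_Diff_column_iso_Bl[of Y X N x] fin disj row card_R_T card_N
      by (auto simp: mult.commute)
    moreover have "(card X - 1) * card Y \<le> card R"
      using card_R_T card_N card_mono[OF fin(2) row(2)] by (simp add: diff_mult_distrib)
    ultimately show ?thesis
      by (simp add: graph_of_converse add.commute)
  qed
qed

lemma fillval_le_deg_sq_imp_part_size:
  assumes fin: "finite X" "finite Y" and R_sub: "R \<subseteq> X \<times> Y" and "card Y \<le> card X"
    and card_parts: "card X + card Y = k + l" and "k \<le> card R"
    and tight: "tight_box (card R) k l" and ge: "fillval k (card R) \<le> deg_sq R"
  shows "deg_sq R = fillval (card X) (card R)"
    and "card X = k \<or> Suc (card X) = k \<and> card R = card X * l"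
proof -
  have "card R \<le> card X * card Y"
    using card_mono[OF _ R_sub] fin by (simp add: card_cartesian_product)
  have "card X \<le> k"
    using tight_box_longest[OF tight card_parts] \<open>card R \<le> card X * card Y\<close> .
  have square: "card R \<le> card X * card X"
    using \<open>card R \<le> card X * card Y\<close> \<open>card Y \<le> card X\<close> by (meson le_trans mult_le_mono2)
  have "0 < card X"
    using card_parts \<open>card Y \<le> card X\<close> tight_box_pos[OF tight] by simp
  then have "fillval (card X) (card R) \<le> fillval k (card R)"
    using square \<open>card X \<le> k\<close> by (rule fillval_mono)
  moreover have "deg_sq R \<le> fillval (card X) (card R)"
    using deg_sq_le_fillval[OF fin R_sub order_refl \<open>card Y \<le> card X\<close>] .
  ultimately show "deg_sq R = fillval (card X) (card R)"
    and "card X = k \<or> Suc (card X) = k \<and> card R = card X * l"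
    using ge fillval_eq_imp_pred[of "card X" "card R" k l] square tight \<open>card X \<le> k\<close> assms(4-6)
    by linarith+
qed

lemma fillval_le_sigma2_if_maximal:
  fixes B :: "'a ugraph"
  assumes B_in: "B \<in> bipartite_graphs (k + l) m"
    and max: "\<forall>H \<in> (bipartite_graphs (k + l) m :: 'a ugraph set). sigma2 H \<le> sigma2 B"
    and tight: "tight_box m k l"
  shows "fillval k m \<le> sigma2 B"
proof -
  have "finite (verts B)" "card (verts B) = k + l"
    using B_in by (simp_all add: bipartite_graphs_def simple_graph_def)
  moreover have "m + (k * l - m) = k * l" "k * l - m \<le> k"
    using tight tight_box_deficit[OF tight] unfolding tight_box_def by linarith+
  ultimately obtain H :: "'a ugraph"
    where "H \<in> bipartite_graphs (k + l) m" "sigma2 H = fillval k m"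
    using obtain_bipartite_graph_sigma2_eq_fillval tight_box_pos(1)[OF tight] by metis
  with max show ?thesis
    by metis
qed

lemma maximal_sigma2_imp_iso_Bl:
  fixes B :: "'a ugraph"
  assumes B_in: "B \<in> bipartite_graphs (k + l) m"
    and max: "\<forall>H \<in> (bipartite_graphs (k + l) m :: 'a ugraph set). sigma2 H \<le> sigma2 B"
    and "k \<le> m" and tight: "tight_box m k l"
  shows "B \<simeq> Bl (k + l) m k \<or> B \<simeq> Bl (k + l) m l \<and> (k - 1) * l \<le> m \<or>
    B \<simeq> Bl (k + l) m (k - 1) \<and> m = (k - 1) * l"
proof -
  obtain X Y R where B_parts: "B = graph_of X Y R" "finite X" "finite Y" "X \<inter> Y = {}" "R \<subseteq> X \<times> Y"
    and card_R: "card R = m" and card_parts: "card X + card Y = k + l" and "card Y \<le> card X"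
    using bipartite_graphs_obtain_graph_of[OF B_in] .
  have "fillval k m \<le> deg_sq R"
    using fillval_le_sigma2_if_maximal[OF B_in max tight] sigma2_graph_of[OF B_parts(2-5)]
      B_parts(1) by simp
  with B_parts card_R card_parts \<open>card Y \<le> card X\<close> \<open>k \<le> m\<close> tight
  have eq: "deg_sq R = fillval (card X) m"
    and size: "card X = k \<or> Suc (card X) = k \<and> m = card X * l"
    using fillval_le_deg_sq_imp_part_size[of X Y R k l] by simp_all
  have "X \<noteq> {}" "Y \<noteq> {}"
    using size card_parts \<open>card Y \<le> card X\<close> tight_box_pos(1)[OF tight] by auto
  note iso = deg_sq_eq_fillval_imp_iso_Bl[OF B_parts(2-5) this, folded B_parts(1),
      unfolded card_R card_parts]
  from size show ?thesis
  proof (elim disjE conjE)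
    assume card_X: "card X = k"
    moreover have "card Y = l" "k * l \<le> m + k"
      using card_X card_parts tight_box_deficit[OF tight] by linarith+
    ultimately show ?thesis
      using iso eq by auto
  next
    assume card_X: "Suc (card X) = k" and m_eq: "m = card X * l"
    then have card_Y: "card Y = Suc l"
      using card_parts by simp
    have "card X = card Y" if "(card X - 1) * card Y \<le> m"
      using that m_eq card_Y \<open>card Y \<le> card X\<close> by (cases "card X") auto
    moreover have "card X * card Y \<le> m + card X"
      by (simp add: m_eq card_Y)
    ultimately have "B \<simeq> Bl (k + l) m (card X)"
      using iso eq by metis
    then show ?thesis
      using card_X m_eq by auto
  qed
qed

section \<open>The parameter \<open>k\<^sub>0\<close>\<close>

lemma k0_condition_iff:
  assumes "k > 0"
  shows "int k \<le> int n - int (m div k) - sgn (int (m mod k)) \<longleftrightarrow> k \<le> n \<and> m \<le> k * (n - k)"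
proof -
  have "int k \<le> int n - int (m div k) - sgn (int (m mod k)) \<longleftrightarrow>
      k \<le> n \<and> m div k + (if m mod k = 0 then 0 else 1) \<le> n - k"
    by (auto simp: sgn_if)
  also have "m div k + (if m mod k = 0 then 0 else 1) \<le> n - k \<longleftrightarrow> m \<le> k * (n - k)"
  proof (cases "m mod k = 0")
    case True
    then show ?thesis
      using assms by auto
  next
    case False
    then have "m \<noteq> (n - k) * k"
      by auto
    then show ?thesis
      using False assms div_less_iff_less_mult[of k m "n - k"] by (auto simp: mult.commute)
  qed
  finally show ?thesis .
qed

lemma k0_feasible:
  assumes "n \<ge> 2" "m \<le> n div 2 * ((n + 1) div 2)"
  shows "n \<le> 2 * k0 n m" "k0 n m \<le> n" "m \<le> k0 n m * (n - k0 n m)"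
proof -
  have k0_cond: "(n + 1) div 2 \<le> k0 n m \<and>
      int (k0 n m) \<le> int n - int (m div k0 n m) - sgn (int (m mod k0 n m))"
    using Max_in[OF k0_set(1)[OF assms]] k0_set(2)[OF assms] unfolding k0_def by blast
  then show "n \<le> 2 * k0 n m"
    by linarith
  then show "k0 n m \<le> n" "m \<le> k0 n m * (n - k0 n m)"
    using k0_cond k0_condition_iff[of "k0 n m" n m] assms(1) by simp_all
qed

lemma le_k0:
  assumes "n \<ge> 2" "m \<le> n div 2 * ((n + 1) div 2)"
    and "n \<le> 2 * k" "k \<le> n" "m \<le> k * (n - k)"
  shows "k \<le> k0 n m"
  unfolding k0_def using assms k0_condition_iff[of k n m]
  by (intro Max_ge[OF k0_set(1)[OF assms(1,2)]]) auto

lemma tight_box_k0: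
  assumes "n \<ge> 2" "0 < m" "m \<le> n div 2 * ((n + 1) div 2)"
  shows "tight_box m (k0 n m) (n - k0 n m)"
proof -
  note k0 = k0_feasible[OF assms(1,3)]
  have "k0 n m \<noteq> n"
    using k0(3) \<open>0 < m\<close> by auto
  then have "(k0 n m + 1) * (n - (k0 n m + 1)) < m"
    using le_k0[OF assms(1,3), of "k0 n m + 1"] k0(1,2) by fastforce
  then show ?thesis
    using k0 by (auto simp: tight_box_def)
qed

theorem theorem2:
  fixes n m :: nat and B :: "'a ugraph"
  assumes "n \<ge> 2"
    and "n \<le> m"
    and "m \<le> n div 2 * ((n + 1) div 2)"
    and "B \<in> bipartite_graphs n m"
    and "\<forall>H \<in> (bipartite_graphs n m :: 'a ugraph set). sigma2 H \<le> sigma2 B"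
  shows "(m > (n - k0 n m) * (k0 n m - 1) \<longrightarrow>
            B \<simeq> Bl n m (k0 n m) \<or> B \<simeq> Bl n m (n - k0 n m)) \<and>
         (m = (n - k0 n m) * (k0 n m - 1) \<longrightarrow>
            B \<simeq> Bl n m (k0 n m) \<or> B \<simeq> Bl n m (n - k0 n m) \<or> B \<simeq> Bl n m (k0 n m - 1)) \<and>
         (m < (n - k0 n m) * (k0 n m - 1) \<longrightarrow>
            B \<simeq> Bl n m (k0 n m))"
proof -
  define k l where "k = k0 n m" and "l = n - k"
  have "n = k + l"
    using k0_feasible(2)[OF assms(1,3)] by (simp add: k_def l_def)
  moreover have "tight_box m k l"
    using tight_box_k0[OF assms(1) _ assms(3)] assms(1,2) by (simp add: k_def l_def)
  ultimately have "B \<simeq> Bl n m k \<or> B \<simeq> Bl n m l \<and> (k - 1) * l \<le> m \<or>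
      B \<simeq> Bl n m (k - 1) \<and> m = (k - 1) * l"
    using assms maximal_sigma2_imp_iso_Bl[of B k l m] by simp
  then show ?thesis
    unfolding k_def[symmetric] l_def[symmetric] by (auto simp: mult.commute)
qed

end
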